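(* Let $T$ be a finite rooted tree. For every finite coloring $c$ of $\mathrm{FIN}^T$ and every sequence $(d_n)_{n\in\omega}$ in $\omega$ there exist sequences $(b_{t,n})_{n\in\omega}$ with $b_{t,n}\in\mathrm{FIN}^T_t$, for $t\in T$, such that: (a) $\mathrm{dom}(b_{t,n})>d_n$ and $\mathrm{dom}(b_{t,n+1})>\mathrm{dom}(b_{t,n})$ for every $t\in T$ and $n\in\omega$; (b) for every $\ell\in\omega$, $n_0<n_1<\cdots<n_\ell$ in $\omega$, $t_0,\dots,t_\ell\in T$ and regressive homomorphisms $f_0,\dots,f_\ell:T\to T$, if $\{f_i(t_i):i\le\ell\}$ is a chain in $T$ with least element $t$, then the color of $\tau_{f_0}(b_{t_0,n_0})+\cdots+\tau_{f_\ell}(b_{t_\ell,n_\ell})$ depends only on $t$.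
   Context: $\omega=\{0,1,\dots\}$. For finite $A,B\subseteq\omega$ and $d\in\omega$, $A>d$ means every element of $A$ exceeds $d$ and $B>A$ means every element of $B$ exceeds every element of $A$ (vacuous for empty sets). A finite rooted tree $T$ with root $r$ is ordered by $t'\le t$ iff $t'$ is a descendant of or equal to $t$; $T^+=T\setminus\{r\}$. A regressive homomorphism is $f:T\to T$ with $f(t)\ge t$ for all $t$ that maps adjacent nodes to the same node or to adjacent nodes. $\mathrm{FIN}^T$ is the set of functions $b:\mathrm{dom}(b)\to T^+$ with $\mathrm{dom}(b)$ a finite (possibly empty) subset of $\omega$ and range contained in a branch of $T$; $b_0+b_1$ is defined iff the domains are disjoint, and then equals $b_0\cup b_1$. For $t\in T^+$, $\mathrm{FIN}^T_t$ is the set of $b\in\mathrm{FIN}^T$ whose range is a chain with least element $t$; $\mathrm{FIN}^T_r=\{\emptyset\}$. For a regressive homomorphism $f$, $\tau_f(b)$ is the function with domain $\{n\in\mathrm{dom}(b):f(b(n))\in T^+\}$ given by $n\mapsto f(b(n))$.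
   Formalization: Regressive homomorphisms are additionally required to preserve the tree order (s ≤ t implies f(s) ≤ f(t)); without this the claim fails, e.g. on the path r > x > p with f(r)=r, f(x)=x, f(p)=r, coloring by range. *)

theory Defs
  imports Main
begin

text \<open>
  A finite rooted tree is given by its set of nodes \<open>T\<close>, its root \<open>r\<close> and the relation \<open>E\<close>
  consisting of the pairs \<open>(child, parent)\<close>.
\<close>

definition finite_rooted_tree :: "'a set \<Rightarrow> 'a \<Rightarrow> ('a \<times> 'a) set \<Rightarrow> bool" where
  "finite_rooted_tree T r E \<longleftrightarrow>
     finite T \<and> r \<in> T \<and> E \<subseteq> T \<times> T \<and>
     (\<nexists>p. (r, p) \<in> E) \<and>
     (\<forall>t \<in> T - {r}. \<exists>!p. (t, p) \<in> E) \<and>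
     (\<forall>t \<in> T. (t, r) \<in> E\<^sup>*)"

text \<open>The root is the largest element of the tree order.\<close>

definition tree_le :: "('a \<times> 'a) set \<Rightarrow> 'a \<Rightarrow> 'a \<Rightarrow> bool" where
  "tree_le E s t \<longleftrightarrow> (s, t) \<in> E\<^sup>*"

definition adjacent :: "('a \<times> 'a) set \<Rightarrow> 'a \<Rightarrow> 'a \<Rightarrow> bool" where
  "adjacent E s t \<longleftrightarrow> (s, t) \<in> E \<or> (t, s) \<in> E"

abbreviation tree_chain :: "'a set \<Rightarrow> ('a \<times> 'a) set \<Rightarrow> 'a set \<Rightarrow> bool" where
  "tree_chain T E \<equiv> pred_on.chain T (tree_le E)"

abbreviation branch :: "'a set \<Rightarrow> ('a \<times> 'a) set \<Rightarrow> 'a set \<Rightarrow> bool" where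
  "branch T E \<equiv> pred_on.maxchain T (tree_le E)"

definition chain_with_least :: "'a set \<Rightarrow> ('a \<times> 'a) set \<Rightarrow> 'a set \<Rightarrow> 'a \<Rightarrow> bool" where
  "chain_with_least T E C t \<longleftrightarrow> tree_chain T E C \<and> t \<in> C \<and> (\<forall>s \<in> C. tree_le E t s)"

text \<open>
  Only the values of \<open>f\<close> on \<open>T\<close> matter. Homomorphisms are homomorphisms of ordered rooted trees: besides
  mapping adjacent nodes to equal or adjacent nodes, they preserve the tree order. Regressiveness and
  the adjacency condition alone do not imply this: on the path \<open>r > x > p > s\<close>, the map with
  \<open>r \<mapsto> r\<close>, \<open>x \<mapsto> x\<close>, \<open>p \<mapsto> x\<close>, \<open>s \<mapsto> r\<close> satisfies both. For such a map \<open>f\<close>, \<open>f t\<close> need not be the least value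
  of \<open>tau T r f b\<close> for \<open>b \<in> FIN_at T r E t\<close>, and the partition theorem fails (color by range).
\<close>

definition regressive_hom :: "'a set \<Rightarrow> ('a \<times> 'a) set \<Rightarrow> ('a \<Rightarrow> 'a) \<Rightarrow> bool" where
  "regressive_hom T E f \<longleftrightarrow>
     f ` T \<subseteq> T \<and>
     (\<forall>t \<in> T. tree_le E t (f t)) \<and>
     (\<forall>s \<in> T. \<forall>t \<in> T. tree_le E s t \<longrightarrow> tree_le E (f s) (f t)) \<and>
     (\<forall>s \<in> T. \<forall>t \<in> T. adjacent E s t \<longrightarrow> f s = f t \<or> adjacent E (f s) (f t))"

definition FIN :: "'a set \<Rightarrow> 'a \<Rightarrow> ('a \<times> 'a) set \<Rightarrow> (nat \<rightharpoonup> 'a) set" where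
  "FIN T r E = {b. finite (dom b) \<and> ran b \<subseteq> T - {r} \<and> (\<exists>B. branch T E B \<and> ran b \<subseteq> B)}"

definition FIN_at :: "'a set \<Rightarrow> 'a \<Rightarrow> ('a \<times> 'a) set \<Rightarrow> 'a \<Rightarrow> (nat \<rightharpoonup> 'a) set" where
  "FIN_at T r E t =
     (if t = r then {Map.empty} else {b \<in> FIN T r E. chain_with_least T E (ran b) t})"

definition tau :: "'a set \<Rightarrow> 'a \<Rightarrow> ('a \<Rightarrow> 'a) \<Rightarrow> (nat \<rightharpoonup> 'a) \<Rightarrow> (nat \<rightharpoonup> 'a)" where
  "tau T r f b = (\<lambda>n. case b n of
     None \<Rightarrow> None
   | Some s \<Rightarrow> if f s \<in> T - {r} then Some (f s) else None)"

text \<open>The partial sum; \<open>None\<close> stands for ``undefined''.\<close>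

definition fin_plus :: "(nat \<rightharpoonup> 'a) \<Rightarrow> (nat \<rightharpoonup> 'a) \<Rightarrow> (nat \<rightharpoonup> 'a) option" where
  "fin_plus b b' = (if dom b \<inter> dom b' = {} then Some (b ++ b') else None)"

text \<open>\<open>b\<^sub>0 + \<dots> + b\<^sub>\<ell>\<close>, defined only if all intermediate sums are.\<close>

definition fin_sum :: "(nat \<rightharpoonup> 'a) list \<Rightarrow> (nat \<rightharpoonup> 'a) option" where
  "fin_sum bs = foldl (\<lambda>s b. Option.bind s (\<lambda>s'. fin_plus s' b)) (Some Map.empty) bs"

definition set_less :: "nat set \<Rightarrow> nat set \<Rightarrow> bool" where
  "set_less A B \<longleftrightarrow> (\<forall>a \<in> A. \<forall>b \<in> B. a < b)"

end

theory Submission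
  imports Defs "HOL-Analysis.Function_Topology"
begin

text \<open>
  An element of \<open>FIN_at T r E t\<close> takes values on the path from \<open>t\<close> to the root, and a regressive
  homomorphism maps this path into itself. Identifying nodes of a path with their depths and colouring a
  function by the colours of its copies on all paths, everything reduces to a single path
  \<open>{0..K}\<close>: the sequence at \<open>t\<close> is a copy of one sequence for \<open>K\<close>, shifted down to the depth of \<open>t\<close>.

  For the path, consider tuples \<open>(u\<^sub>j)\<close> of ultrafilters, \<open>u\<^sub>j\<close> concentrating on functions with maximum
  \<open>j\<close> and arbitrarily late support, such that \<open>f (u\<^sub>j) = u (f j)\<close> for every collapsing map \<open>f\<close>. They
  form a compact right topological semigroup. If \<open>u\<close> is idempotent, then \<open>j \<mapsto> u\<^sub>0 + \<dots> + u\<^sub>j\<close> and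
  \<open>j \<mapsto> u\<^sub>j + \<dots> + u\<^sub>0\<close> are again such tuples, because \<open>f\<close> only creates repetitions in these sums. With
  these and Ellis' lemma one finds a tuple with \<open>u\<^sub>i + u\<^sub>j = u (max i j)\<close>, from which
  the sequence is built by the Galvin-Glazer argument. There, an index missing from \<open>n\<^sub>0 < \<dots> < n\<^sub>l\<close> is
  accounted for by the collapsing map \<open>0\<close>.
\<close>

section \<open>Idempotents in compact right topological semigroups\<close>

text \<open>Tuples of ultrafilters live in an iterated function space over \<open>bool\<close>;
  separating them at a coordinate makes compact sets of tuples closed.\<close>

instance "fun" :: (type, t2_space) t2_space
proof
  fix f g :: "'a \<Rightarrow> 'b"
  assume "f \<noteq> g"
  then obtain i where "f i \<noteq> g i" by auto
  then obtain U V where UV: "open U" "open V" "f i \<in> U" "g i \<in> V" "U \<inter> V = {}"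
    by (meson hausdorff)
  have "open ((\<lambda>h. h i) -` U)" if "open U" for U :: "'b set"
    using that by (auto intro: open_vimage)
  with UV show "\<exists>U V. open U \<and> open V \<and> f \<in> U \<and> g \<in> V \<and> U \<inter> V = {}"
    by (intro exI[of _ "(\<lambda>h. h i) -` U"] exI[of _ "(\<lambda>h. h i) -` V"]) auto
qed

lemma compact_UNIV_fun:
  assumes "compact (UNIV :: 'b::topological_space set)"
  shows "compact (UNIV :: ('a \<Rightarrow> 'b) set)"
proof -
  have "compact_space (product_topology (\<lambda>i::'a. euclidean :: 'b topology) UNIV)"
    unfolding compact_space_product_topology using assms by (simp add: compact_space_def)
  then show ?thesis
    by (simp add: euclidean_product_topology compact_space_def)
qed

text \<open>A finite subfamily of a chain has a least member, which is nonempty; the finite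
  intersection property does the rest.\<close>

lemma compact_subchain_Inter:
  fixes \<C> :: "'a::t2_space set set"
  assumes "\<C> \<noteq> {}" and comp: "\<And>X. X \<in> \<C> \<Longrightarrow> compact X \<and> X \<noteq> {}"
    and chain: "\<And>X Y. X \<in> \<C> \<Longrightarrow> Y \<in> \<C> \<Longrightarrow> X \<subseteq> Y \<or> Y \<subseteq> X"
  shows "compact (\<Inter>\<C>) \<and> \<Inter>\<C> \<noteq> {}"
proof
  obtain X0 where X0: "X0 \<in> \<C>" using assms(1) by auto
  have closed: "closed X" if "X \<in> \<C>" for X
    using comp[OF that] compact_imp_closed by blast
  have eq: "X0 \<inter> \<Inter>\<C> = \<Inter>\<C>" using X0 by auto
  show "compact (\<Inter>\<C>)"
    using compact_Int_closed[of X0 "\<Inter>\<C>"] comp[OF X0] closed eq by auto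
  have least: "\<exists>X\<in>\<F>. X \<subseteq> \<Inter>\<F>" if "finite \<F>" "\<F> \<noteq> {}" "\<F> \<subseteq> \<C>" for \<F>
    using that
  proof (induction \<F> rule: finite_ne_induct)
    case (insert Y \<F>)
    then obtain X where "X \<in> \<F>" "X \<subseteq> \<Inter>\<F>" by auto
    moreover have "X \<subseteq> Y \<or> Y \<subseteq> X" using chain insert.prems \<open>X \<in> \<F>\<close> by auto
    ultimately show ?case by auto
  qed auto
  have "X0 \<inter> \<Inter>\<F> \<noteq> {}" if "finite \<F>" "\<F> \<subseteq> \<C>" for \<F>
  proof -
    obtain X where "X \<in> insert X0 \<F>" "X \<subseteq> \<Inter>(insert X0 \<F>)"
      using least[of "insert X0 \<F>"] \<open>finite \<F>\<close> \<open>\<F> \<subseteq> \<C>\<close> X0 by blast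
    moreover have "X \<noteq> {}" using comp \<open>X \<in> insert X0 \<F>\<close> X0 \<open>\<F> \<subseteq> \<C>\<close> by auto
    ultimately show ?thesis by blast
  qed
  then show "\<Inter>\<C> \<noteq> {}"
    using compact_imp_fip[of X0 \<C>] comp[OF X0] closed eq by auto
qed

text \<open>Take a minimal compact subsemigroup \<open>M\<close> and \<open>e\<close> in it. By
  minimality \<open>M \<odot> e\<close> is \<open>M\<close>, so \<open>u \<odot> e = e\<close> is
  solvable in \<open>M\<close>. The solutions form a compact subsemigroup, hence are all of
  \<open>M\<close>, and \<open>e\<close> is one of them.\<close>

lemma Ellis_idempotent:
  fixes mult :: "'u::t2_space \<Rightarrow> 'u \<Rightarrow> 'u" (infixl "\<odot>" 70)
  assumes assoc: "\<And>u v w. (u \<odot> v) \<odot> w = u \<odot> (v \<odot> w)"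
    and cont: "\<And>v. continuous_on UNIV (\<lambda>u. u \<odot> v)"
    and S: "compact S" "S \<noteq> {}" "\<And>u v. u \<in> S \<Longrightarrow> v \<in> S \<Longrightarrow> u \<odot> v \<in> S"
  shows "\<exists>e\<in>S. e \<odot> e = e"
proof -
  define A where "A = {X. X \<subseteq> S \<and> compact X \<and> X \<noteq> {} \<and> (\<forall>u\<in>X. \<forall>v\<in>X. u \<odot> v \<in> X)}"
  have "\<exists>M\<in>A. \<forall>X\<in>A. X \<subseteq> M \<longrightarrow> X = M"
  proof (rule predicate_Zorn)
    show "partial_order_on A (relation_of (\<lambda>X Y. Y \<subseteq> X) A)"
      by (auto simp: partial_order_on_def preorder_on_def refl_on_def relation_of_def
          intro!: transI antisymI)
  next
    fix C assume C: "C \<in> Chains (relation_of (\<lambda>X Y. Y \<subseteq> X) A)"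
    then have CA: "C \<subseteq> A" and lin: "\<And>X Y. X \<in> C \<Longrightarrow> Y \<in> C \<Longrightarrow> X \<subseteq> Y \<or> Y \<subseteq> X"
      by (auto simp: Chains_def relation_of_def)
    show "\<exists>u\<in>A. \<forall>a\<in>C. u \<subseteq> a"
    proof (cases "C = {}")
      case True
      then show ?thesis using S by (auto simp: A_def intro!: exI[of _ S])
    next
      case False
      have "compact (\<Inter>C) \<and> \<Inter>C \<noteq> {}"
        using False CA lin by (intro compact_subchain_Inter) (auto simp: A_def)
      moreover have "\<Inter>C \<subseteq> S" using False CA by (force simp: A_def)
      moreover have "\<forall>u\<in>\<Inter>C. \<forall>v\<in>\<Inter>C. u \<odot> v \<in> \<Inter>C"
        using CA by (auto simp: A_def)
      ultimately have "\<Inter>C \<in> A" unfolding A_def by blast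
      then show ?thesis by (intro bexI[of _ "\<Inter>C"]) auto
    qed
  qed
  then obtain M where M: "M \<in> A" and min: "\<And>X. X \<in> A \<Longrightarrow> X \<subseteq> M \<Longrightarrow> X = M" by blast
  then obtain e where e: "e \<in> M" by (auto simp: A_def)
  note M' = M[unfolded A_def mem_Collect_eq]
  have "compact ((\<lambda>u. u \<odot> e) ` M)"
    using M' cont continuous_on_subset by (intro compact_continuous_image) blast+
  then have "(\<lambda>u. u \<odot> e) ` M \<in> A"
    using M' e by (auto simp: A_def assoc[symmetric])
  then have img: "(\<lambda>u. u \<odot> e) ` M = M"
    using M' e by (intro min) auto
  define X where "X = M \<inter> {u. u \<odot> e = e}"
  have "closed {u. u \<odot> e = e}"
    by (intro closed_Collect_eq cont continuous_on_const)
  then have "compact X" unfolding X_def using M' by (intro compact_Int_closed) auto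
  moreover have "X \<noteq> {}" using img e by (auto simp: X_def set_eq_iff) (metis (mono_tags, lifting) imageE)
  moreover have "u \<odot> v \<in> X" if "u \<in> X" "v \<in> X" for u v
    using that M' by (auto simp: X_def assoc)
  ultimately have "X \<in> A" using M' by (auto simp: A_def X_def)
  then have "X = M" by (intro min) (auto simp: X_def)
  then show ?thesis using e M' by (auto simp: X_def)
qed

section \<open>Products along a tuple and absorption\<close>

primrec ascending_product :: "('u \<Rightarrow> 'u \<Rightarrow> 'u) \<Rightarrow> (nat \<Rightarrow> 'u) \<Rightarrow> nat \<Rightarrow> 'u" where
  "ascending_product mult u 0 = u 0"
| "ascending_product mult u (Suc j) = mult (ascending_product mult u j) (u (Suc j))"

primrec descending_product :: "('u \<Rightarrow> 'u \<Rightarrow> 'u) \<Rightarrow> (nat \<Rightarrow> 'u) \<Rightarrow> nat \<Rightarrow> 'u" where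
  "descending_product mult u 0 = u 0"
| "descending_product mult u (Suc j) = mult (u (Suc j)) (descending_product mult u j)"

text \<open>The product up to \<open>j\<close> begins with \<open>u j\<close>, so earlier entries
  act on it as left units. This settles a shorter product times a longer one; in the other order,
  the leading factors of the longer one are peeled off until both agree.\<close>

lemma descending_product_absorbing:
  fixes mult :: "'u \<Rightarrow> 'u \<Rightarrow> 'u" (infixl "\<odot>" 70)
  assumes assoc: "\<And>u v w. (u \<odot> v) \<odot> w = u \<odot> (v \<odot> w)"
    and left: "\<And>i j. i \<le> K \<Longrightarrow> i \<le> j \<Longrightarrow> u i \<odot> u j = u j"
    and "i \<le> K" "j \<le> K"
  shows "descending_product mult u i \<odot> descending_product mult u j
    = descending_product mult u (max i j)"
proof -
  let ?D = "descending_product mult u"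
  have 1: "u i \<odot> ?D j = ?D j" if "i \<le> K" "i \<le> j" for i j
    using that by (cases j) (simp_all add: left assoc[symmetric])
  have 2: "?D i \<odot> ?D j = ?D j" if "i \<le> K" "i \<le> j" for i j
    using that by (induction i) (simp_all add: 1 assoc)
  have 3: "?D j \<odot> ?D i = ?D j" if "i \<le> j" "j \<le> K" for i j
    using that
  proof (induction rule: dec_induct)
    case base
    then show ?case by (simp add: 2)
  next
    case (step n)
    then show ?case by (simp add: assoc)
  qed
  show ?thesis
    using 2[of i j] 3[of j i] assms(3,4) by (cases "i \<le> j") (auto simp: max_def)
qed

text \<open>
  Idempotents are improved one index at a time: \<open>u i\<close> is made a left unit of every later entry.
  Starting from an idempotent \<open>u\<close>, the ascending product \<open>a\<close> of \<open>u\<close> already has this property for the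
  next index, and \<open>a \<otimes> e \<otimes> y\<close>, for an idempotent \<open>e = y \<otimes> a\<close>, is an idempotent beginning with \<open>a\<close>.
  Once all indices are treated, the descending product absorbs from both sides.
\<close>

lemma absorbing_tuple_exists:
  fixes mult :: "'u::t2_space \<Rightarrow> 'u \<Rightarrow> 'u" (infixl "\<odot>" 70) and W :: "(nat \<Rightarrow> 'u) set"
  assumes assoc: "\<And>u v w. (u \<odot> v) \<odot> w = u \<odot> (v \<odot> w)"
    and cont: "\<And>v. continuous_on UNIV (\<lambda>u. u \<odot> v)"
    and W: "compact W" "W \<noteq> {}" "\<And>u v. u \<in> W \<Longrightarrow> v \<in> W \<Longrightarrow> (\<lambda>j. u j \<odot> v j) \<in> W"
    and asc: "\<And>u. u \<in> W \<Longrightarrow> (\<And>j. u j \<odot> u j = u j) \<Longrightarrow> ascending_product mult u \<in> W"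
    and desc: "\<And>u. u \<in> W \<Longrightarrow> (\<And>j. u j \<odot> u j = u j) \<Longrightarrow> descending_product mult u \<in> W"
  shows "\<exists>u\<in>W. \<forall>i\<le>K. \<forall>j\<le>K. u i \<odot> u j = u (max i j)"
proof -
  define tmult (infixl "\<otimes>" 70) where "u \<otimes> v = (\<lambda>j. u j \<odot> v j)" for u v :: "nat \<Rightarrow> 'u"
  have tassoc: "(u \<otimes> v) \<otimes> w = u \<otimes> (v \<otimes> w)" for u v w
    by (simp add: tmult_def assoc)
  have tcont: "continuous_on UNIV (\<lambda>u. u \<otimes> v)" for v
    unfolding tmult_def
    by (intro continuous_on_coordinatewise_then_product
        continuous_on_compose2[OF cont continuous_on_product_coordinates]) auto
  have tW: "u \<otimes> v \<in> W" if "u \<in> W" "v \<in> W" for u v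
    using W(3) that by (simp add: tmult_def)
  note Ellis = Ellis_idempotent[where mult = tmult, OF tassoc tcont]
  have "\<exists>u\<in>W. u \<otimes> u = u \<and> (\<forall>i<m. \<forall>j\<ge>i. u i \<odot> u j = u j)" for m
  proof (induction m)
    case 0
    then show ?case using Ellis[of W] W tW by auto
  next
    case (Suc m)
    then obtain u where u: "u \<in> W" "u \<otimes> u = u" and abs: "\<And>i j. i < m \<Longrightarrow> i \<le> j \<Longrightarrow> u i \<odot> u j = u j"
      by blast
    have idem: "u j \<odot> u j = u j" for j using fun_cong[OF u(2), of j] by (simp add: tmult_def)
    define a where "a = ascending_product mult u"
    have aW: "a \<in> W" using asc u(1) idem by (simp add: a_def)
    have a_eq: "a i = u i" if "i \<le> m" for i
      using that by (induction i) (auto simp: a_def abs)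
    have u_a: "u i \<odot> a j = a j" if "i \<le> m" "i \<le> j" for i j
      using that(2,1)
    proof (induction rule: dec_induct)
      case base
      then show ?case by (simp add: a_eq idem)
    next
      case (step n)
      then show ?case by (simp add: a_def assoc[symmetric])
    qed
    \<comment> \<open>Fixing the entries up to \<open>m\<close> leaves a subsemigroup because these
      entries are idempotent.\<close>
    define V where "V = W \<inter> {v. \<forall>i. i \<le> m \<longrightarrow> v i = u i}"
    have "closed {v. \<forall>i. i \<le> m \<longrightarrow> v i = u i}"
      by (intro closed_Collect_all closed_Collect_imp closed_Collect_eq) auto
    then have "compact V" unfolding V_def using W(1) by (intro compact_Int_closed) auto
    have VV: "v \<otimes> w \<in> V" if "v \<in> V" "w \<in> V" for v w
      using that tW idem by (auto simp: V_def) (simp add: tmult_def)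
    have aV: "a \<in> V" using aW a_eq by (simp add: V_def)
    \<comment> \<open>Ellis' lemma is applied to the left ideal \<open>V \<otimes> a\<close> so that
      the idempotent has the form \<open>y \<otimes> a\<close>.\<close>
    have "compact ((\<lambda>v. v \<otimes> a) ` V)"
      using \<open>compact V\<close> tcont continuous_on_subset by (intro compact_continuous_image) blast+
    moreover have "v \<otimes> w \<in> (\<lambda>v. v \<otimes> a) ` V"
      if vw: "v \<in> (\<lambda>v. v \<otimes> a) ` V" "w \<in> (\<lambda>v. v \<otimes> a) ` V" for v w
    proof -
      obtain w' where "w' \<in> V" "w = w' \<otimes> a" using vw by auto
      moreover have "v \<in> V" using vw VV aV by auto
      ultimately show ?thesis using VV by (auto simp: tassoc[symmetric])
    qed
    ultimately obtain y where y: "y \<in> V" and e: "(y \<otimes> a) \<otimes> (y \<otimes> a) = y \<otimes> a"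
      using Ellis[of "(\<lambda>v. v \<otimes> a) ` V"] aV by auto
    define q where "q = a \<otimes> (y \<otimes> a) \<otimes> y"
    have "q \<otimes> q = a \<otimes> (((y \<otimes> a) \<otimes> (y \<otimes> a)) \<otimes> (y \<otimes> a)) \<otimes> y"
      by (simp add: q_def tassoc)
    also have "\<dots> = q" by (simp only: e q_def)
    finally have qq: "q \<otimes> q = q" .
    have "q \<in> V" unfolding q_def using VV aV y by simp
    then have q_eq: "q i = u i" if "i \<le> m" for i using that by (simp add: V_def)
    \<comment> \<open>Each \<open>q j\<close> begins with \<open>a j\<close>, for which
      \<open>u i\<close> is a left unit by \<open>u_a\<close>.\<close>
    have "q i \<odot> q j = q j" if "i < Suc m" "i \<le> j" for i j
    proof -
      have "u i \<odot> q j = (u i \<odot> a j) \<odot> ((y \<otimes> a) j \<odot> y j)"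
        by (simp add: q_def tmult_def assoc)
      also have "\<dots> = q j" using that by (simp add: u_a) (simp add: q_def tmult_def assoc)
      finally show ?thesis using that by (simp add: q_eq)
    qed
    then show ?case using qq \<open>q \<in> V\<close> by (auto simp: V_def)
  qed
  from this[of "Suc K"] obtain u where u: "u \<in> W" "u \<otimes> u = u"
    and abs: "\<And>i j. i \<le> K \<Longrightarrow> i \<le> j \<Longrightarrow> u i \<odot> u j = u j"
    by (auto simp: less_Suc_eq_le)
  have "u j \<odot> u j = u j" for j using fun_cong[OF u(2), of j] by (simp add: tmult_def)
  then have "descending_product mult u \<in> W" using desc u(1) by blast
  moreover have "descending_product mult u i \<odot> descending_product mult u j
    = descending_product mult u (max i j)" if "i \<le> K" "j \<le> K" for i j
    using descending_product_absorbing[where mult = mult and u = u and K = K] assoc abs that by auto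
  ultimately show ?thesis by blast
qed

section \<open>Ultrafilters\<close>

text \<open>Encoded as a \<open>bool\<close>-valued function on sets, so that pointwise convergence
  gives the Stone topology.\<close>

definition ultra :: "('a set \<Rightarrow> bool) \<Rightarrow> bool" where
  "ultra u \<longleftrightarrow> u UNIV \<and> (\<forall>A B. u (A \<inter> B) \<longleftrightarrow> u A \<and> u B) \<and> (\<forall>A. u (- A) \<longleftrightarrow> \<not> u A)"

definition principal_ultra :: "'a \<Rightarrow> 'a set \<Rightarrow> bool" where
  "principal_ultra x = (\<lambda>A. x \<in> A)"

definition ultra_map :: "('a \<Rightarrow> 'b) \<Rightarrow> ('a set \<Rightarrow> bool) \<Rightarrow> 'b set \<Rightarrow> bool" where
  "ultra_map f u = (\<lambda>A. u {x. f x \<in> A})"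

text \<open>With \<open>u\<close> quantified outermost the product is continuous in
  \<open>u\<close>: its value at \<open>A\<close> is \<open>u\<close> evaluated at a set determined
  by \<open>v\<close> and \<open>A\<close>.\<close>

definition ultra_mult :: "('a \<Rightarrow> 'a \<Rightarrow> 'a) \<Rightarrow> ('a set \<Rightarrow> bool) \<Rightarrow> ('a set \<Rightarrow> bool) \<Rightarrow> 'a set \<Rightarrow> bool" where
  "ultra_mult f u v = (\<lambda>A. u {x. v {y. f x y \<in> A}})"

lemma ultra_principal: "ultra (principal_ultra x)"
  by (simp add: ultra_def principal_ultra_def)

lemma ultra_map_principal: "ultra_map f (principal_ultra x) = principal_ultra (f x)"
  by (simp add: ultra_map_def principal_ultra_def)

lemma ultra_mono: "ultra u \<Longrightarrow> u A \<Longrightarrow> A \<subseteq> B \<Longrightarrow> u B"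
  unfolding ultra_def by (metis inf.absorb2 inf.commute)

lemma ultra_Collect_conj: "ultra u \<Longrightarrow> u {x. P x \<and> Q x} \<longleftrightarrow> u {x. P x} \<and> u {x. Q x}"
  unfolding ultra_def by (metis Collect_conj_eq)

lemma ultra_Collect_not: "ultra u \<Longrightarrow> u {x. \<not> P x} \<longleftrightarrow> \<not> u {x. P x}"
  unfolding ultra_def by (metis Collect_neg_eq)

lemma ultra_Collect_ball:
  assumes "ultra u" "finite I"
  shows "u {x. \<forall>i\<in>I. P i x} \<longleftrightarrow> (\<forall>i\<in>I. u {x. P i x})"
  using assms(2)
proof (induction I)
  case empty
  then show ?case using assms(1) by (simp add: ultra_def)
next
  case (insert i I)
  then show ?case using assms(1) ultra_Collect_conj[of u "P i"] by simp
qed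

lemma ultra_nonempty: "ultra u \<Longrightarrow> u A \<Longrightarrow> A \<noteq> {}"
  unfolding ultra_def by (metis Compl_empty_eq)

text \<open>Otherwise the complements of the finitely many colour classes would all be large,
  although their intersection is empty.\<close>

lemma ultra_colour:
  assumes "ultra u" "finite (range c)"
  shows "\<exists>k. u {x. c x = k}"
proof (rule ccontr)
  assume "\<not> (\<exists>k. u {x. c x = k})"
  then have "u {x. c x \<noteq> k}" for k
    using ultra_Collect_not[OF assms(1), of "\<lambda>x. c x = k"] by simp
  then have "u {x. \<forall>k\<in>range c. c x \<noteq> k}"
    unfolding ultra_Collect_ball[OF assms] by blast
  then show False using ultra_nonempty[OF assms(1)] by auto
qed

lemma ultra_ultra_mult: "ultra u \<Longrightarrow> ultra v \<Longrightarrow> ultra (ultra_mult f u v)"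
  by (simp add: ultra_def ultra_mult_def Collect_neg_eq Collect_conj_eq)

lemma ultra_map_mult:
  assumes "\<And>x y. h (f x y) = f (h x) (h y)"
  shows "ultra_map h (ultra_mult f u v) = ultra_mult f (ultra_map h u) (ultra_map h v)"
  by (simp add: ultra_mult_def ultra_map_def assms)

lemma ultra_mult_mem:
  assumes "ultra u" "ultra v" "u A" "v B" "\<And>x y. x \<in> A \<Longrightarrow> y \<in> B \<Longrightarrow> f x y \<in> C"
  shows "ultra_mult f u v C"
proof -
  have "v {y. f x y \<in> C}" if "x \<in> A" for x
    by (rule ultra_mono[OF assms(2,4)]) (use assms(5) that in auto)
  then show ?thesis
    unfolding ultra_mult_def by (intro ultra_mono[OF assms(1,3)]) auto
qed

lemma continuous_on_ultra_mult: "continuous_on UNIV (\<lambda>u. ultra_mult f u v)"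
  unfolding ultra_mult_def by (intro continuous_on_coordinatewise_then_product) simp

lemma compact_UNIV_ultra_tuples: "compact (UNIV :: ('i \<Rightarrow> 'a set \<Rightarrow> bool) set)"
  by (intro compact_UNIV_fun finite_imp_compact) simp

section \<open>Collapsing maps acting on blocks\<close>

text \<open>These maps describe how a regressive homomorphism changes depths along a path.\<close>

definition collapse :: "(nat \<Rightarrow> nat) set" where
  "collapse = {f. f 0 = 0 \<and> (\<forall>n. f (Suc n) = f n \<or> f (Suc n) = Suc (f n))}"

text \<open>
  Elements of \<open>FIN\<^sub>K\<close> are total functions that are \<open>0\<close> outside the domain, so that the partial sum
  of disjoint blocks becomes the restriction of a total operation.
\<close>

definition merge :: "(nat \<Rightarrow> nat) \<Rightarrow> (nat \<Rightarrow> nat) \<Rightarrow> nat \<Rightarrow> nat" where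
  "merge b b' = (\<lambda>x. max (b x) (b' x))"

definition act :: "(nat \<Rightarrow> nat) \<Rightarrow> (nat \<Rightarrow> nat) \<Rightarrow> nat \<Rightarrow> nat" where
  "act f b = (\<lambda>x. f (b x))"

text \<open>The height \<open>j\<close> is attained, as the least node is in \<open>FIN_at\<close>;
  for \<open>j = 0\<close> only the zero function remains, as at the root. The bound
  \<open>m\<close> forces late support.\<close>

definition blocks :: "nat \<Rightarrow> nat \<Rightarrow> (nat \<Rightarrow> nat) set" where
  "blocks m j = {b. finite {x. b x \<noteq> 0} \<and> (\<forall>x\<le>m. b x = 0) \<and> (\<forall>x. b x \<le> j) \<and> (\<exists>x. b x = j)}"

lemma merge_assoc: "merge (merge a b) c = merge a (merge b c)"
  by (simp add: merge_def max.assoc)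

lemma ultra_mult_merge_assoc:
  "ultra_mult merge (ultra_mult merge u v) w = ultra_mult merge u (ultra_mult merge v w)"
  by (simp add: ultra_mult_def merge_assoc)

lemma collapse_Suc:
  assumes "f \<in> collapse"
  obtains "f (Suc n) = f n" | "f (Suc n) = Suc (f n)"
  using assms by (auto simp: collapse_def)

lemma collapse_mono:
  assumes "f \<in> collapse" "i \<le> j"
  shows "f i \<le> f j"
proof -
  have "f n \<le> f (Suc n)" for n using collapse_Suc[OF assms(1), of n] by force
  then show ?thesis using assms(2) by (rule lift_Suc_mono_le)
qed

lemma collapse_le: "f \<in> collapse \<Longrightarrow> f j \<le> j"
proof (induction j)
  case (Suc j)
  with collapse_Suc[of f j] show ?case by force
qed (simp add: collapse_def)

lemma collapse_0: "f \<in> collapse \<Longrightarrow> f 0 = 0"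
  by (simp add: collapse_def)

lemma collapse_compose:
  assumes "f \<in> collapse" "g \<in> collapse"
  shows "(\<lambda>j. f (g j)) \<in> collapse"
proof -
  have "f (g (Suc n)) = f (g n) \<or> f (g (Suc n)) = Suc (f (g n))" for n
    using collapse_Suc[OF assms(2), of n] collapse_Suc[OF assms(1), of "g n"] by metis
  then show ?thesis using assms by (simp add: collapse_def)
qed

text \<open>Monotone maps commute with maxima, so collapsing maps act as endomorphisms.\<close>

lemma act_merge: "f \<in> collapse \<Longrightarrow> act f (merge b b') = merge (act f b) (act f b')"
  using collapse_mono[of f] by (simp add: act_def merge_def max_of_mono monoI fun_eq_iff)

lemma collapse_min:
  assumes "f \<in> collapse"
  shows "(\<lambda>j. f (min j K)) \<in> collapse"
proof -
  have "f (min (Suc n) K) = f (min n K) \<or> f (min (Suc n) K) = Suc (f (min n K))" for n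
    using assms by (cases "n < K") (auto simp: collapse_def min_def)
  then show ?thesis using assms by (simp add: collapse_def)
qed

text \<open>The values up to \<open>K\<close> determine such a map and, since
  \<open>f j \<le> j\<close>, lie in \<open>{..K}\<close>. Finiteness lets one large set of blocks
  serve all these maps.\<close>

lemma finite_collapse_bounded: "finite {f \<in> collapse. \<forall>j\<ge>K. f j = f K}" (is "finite ?M")
proof (rule finite_imageD)
  have le: "f j \<le> K" if "f \<in> ?M" "j \<le> K" for f j
    using collapse_le[of f j] that(2) le_trans that(1) by blast
  have "(\<lambda>f. restrict f {..K}) ` ?M \<subseteq> {..K} \<rightarrow>\<^sub>E {..K}"
    by (intro image_subsetI restrict_PiE_iff[THEN iffD2] ballI, unfold atMost_iff) (rule le)
  moreover have "finite ({..K} \<rightarrow>\<^sub>E {..K})"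
    by (rule finite_PiE) simp_all
  ultimately show "finite ((\<lambda>f. restrict f {..K}) ` ?M)"
    by (rule finite_subset)
  show "inj_on (\<lambda>f. restrict f {..K}) ?M"
  proof (rule inj_onI, rule ext)
    fix f g j
    assume fg: "f \<in> ?M" "g \<in> ?M" "restrict f {..K} = restrict g {..K}"
    then have *: "f j = g j" if "j \<le> K" for j
      using that by (metis atMost_iff restrict_apply')
    show "f j = g j"
    proof (cases "j \<le> K")
      case False
      then have "f j = f K" "g j = g K" using fg(1,2) nat_le_linear by blast+
      with * show ?thesis by simp
    qed (fact *)
  qed
qed

lemma merge_blocks:
  assumes "b \<in> blocks m i" "b' \<in> blocks m j"
  shows "merge b b' \<in> blocks m (max i j)"
proof -
  note b = assms[unfolded blocks_def mem_Collect_eq]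
  have "{x. merge b b' x \<noteq> 0} \<subseteq> {x. b x \<noteq> 0} \<union> {x. b' x \<noteq> 0}"
    by (auto simp: merge_def)
  then have "finite {x. merge b b' x \<noteq> 0}"
    using b finite_subset by blast
  moreover have "\<exists>x. merge b b' x = max i j"
  proof (cases "i \<le> j")
    case True
    then obtain x where "b' x = j" "b x \<le> j" using b le_trans by blast
    with True show ?thesis by (auto simp: merge_def intro: exI[of _ x])
  next
    case False
    then obtain x where "b x = i" "b' x \<le> i" using b le_trans nat_le_linear by blast
    with False show ?thesis by (auto simp: merge_def intro!: exI[of _ x])
  qed
  moreover have "\<forall>x. merge b b' x \<le> max i j"
    using b by (simp add: merge_def max.coboundedI1 max.coboundedI2)
  moreover have "\<forall>x\<le>m. merge b b' x = 0"
    using b by (simp add: merge_def)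
  ultimately show ?thesis unfolding blocks_def by blast
qed

lemma blocks_0: "blocks m 0 = {\<lambda>_. 0}"
  by (auto simp: blocks_def)

section \<open>Equivariant tuples of ultrafilters\<close>

definition equivariant_tuples :: "(nat \<Rightarrow> (nat \<Rightarrow> nat) set \<Rightarrow> bool) set" where
  "equivariant_tuples =
     {u. (\<forall>j. ultra (u j)) \<and> (\<forall>j m. u j (blocks m j)) \<and>
         (\<forall>f\<in>collapse. \<forall>j. ultra_map (act f) (u j) = u (f j))}"

text \<open>Demanding support beyond a single \<open>m\<close> gives sets \<open>Z m\<close> that
  decrease with \<open>m\<close>. Each is compact and nonempty, hence so is their
  intersection.\<close>

lemma compact_equivariant_tuples:
  "compact equivariant_tuples" "equivariant_tuples \<noteq> {}"
proof -
  define Z :: "nat \<Rightarrow> (nat \<Rightarrow> (nat \<Rightarrow> nat) set \<Rightarrow> bool) set" where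
    "Z m = {u. (\<forall>j. ultra (u j)) \<and> (\<forall>j. u j (blocks m j)) \<and>
         (\<forall>f\<in>collapse. \<forall>j. ultra_map (act f) (u j) = u (f j))}" for m
  have eq: "equivariant_tuples = \<Inter>(range Z)"
    by (auto simp: equivariant_tuples_def Z_def)
  \<comment> \<open>Evaluation at a set is continuous into discrete \<open>bool\<close>, so
    \<open>u j A\<close> is a clopen condition, and the defining conditions are conjunctions of
    Boolean combinations of such.\<close>
  have cont: "continuous_on UNIV (\<lambda>u :: nat \<Rightarrow> (nat \<Rightarrow> nat) set \<Rightarrow> bool. u j A)" for j A
    by (rule continuous_on_product_then_coordinatewise) simp
  have eq_vimage: "{u. u j A} = (\<lambda>u. u j A) -` {True}" for j and A :: "(nat \<Rightarrow> nat) set"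
    by auto
  have op: "open {u :: nat \<Rightarrow> (nat \<Rightarrow> nat) set \<Rightarrow> bool. u j A}" for j A
    unfolding eq_vimage by (rule open_vimage[OF open_discrete cont])
  have cl: "closed {u :: nat \<Rightarrow> (nat \<Rightarrow> nat) set \<Rightarrow> bool. u j A}" for j A
    unfolding eq_vimage by (rule closed_vimage[OF _ cont]) (simp add: closed_def open_discrete)
  have "closed {u :: nat \<Rightarrow> (nat \<Rightarrow> nat) set \<Rightarrow> bool. ultra (u j)}" for j
    unfolding ultra_def iff_conv_conj_imp
    by (intro closed_Collect_conj closed_Collect_all closed_Collect_imp closed_Collect_neg
        open_Collect_conj open_Collect_neg op cl)
  moreover have "closed {u :: nat \<Rightarrow> (nat \<Rightarrow> nat) set \<Rightarrow> bool.
      \<forall>f\<in>collapse. \<forall>j. ultra_map (act f) (u j) = u (f j)}"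
    unfolding ultra_map_def fun_eq_iff Ball_def iff_conv_conj_imp
    by (intro closed_Collect_conj closed_Collect_all closed_Collect_imp open_Collect_const op cl)
  ultimately have "closed (Z m)" for m
    unfolding Z_def by (intro closed_Collect_conj closed_Collect_all cl)
  then have comp: "compact (Z m)" for m
    using compact_Int_closed[OF compact_UNIV_ultra_tuples, of "Z m"] by simp
  have ne: "Z m \<noteq> {}" for m
  proof -
    \<comment> \<open>Blocks living on the single point \<open>Suc m\<close> are already
      equivariant, and so are their principal ultrafilters.\<close>
    define p :: "nat \<Rightarrow> nat \<Rightarrow> nat" where "p j x = (if x = Suc m then j else 0)" for j x
    have "p j \<in> blocks m j" for j
      by (auto simp: p_def blocks_def)
    moreover have "act f (p j) = p (f j)" if "f \<in> collapse" for f j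
      using that by (auto simp: act_def p_def collapse_def fun_eq_iff)
    ultimately have "(\<lambda>j. principal_ultra (p j)) \<in> Z m"
      unfolding Z_def by (simp add: ultra_principal ultra_map_principal) (simp add: principal_ultra_def)
    then show ?thesis by blast
  qed
  have sub: "Z n \<subseteq> Z m" if "m \<le> n" for m n
  proof -
    have "blocks n j \<subseteq> blocks m j" for j using that by (auto simp: blocks_def)
    then have "v (blocks m j)" if "ultra v" "v (blocks n j)" for v j
      using ultra_mono that by metis
    then show ?thesis unfolding Z_def by (intro subsetI) (simp, metis)
  qed
  have "compact (\<Inter>(range Z)) \<and> \<Inter>(range Z) \<noteq> {}"
  proof (rule compact_subchain_Inter)
    fix X Y assume "X \<in> range Z" "Y \<in> range Z"
    then obtain m n where "X = Z m" "Y = Z n" by blast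
    then show "X \<subseteq> Y \<or> Y \<subseteq> X" using sub nat_le_linear by blast
  qed (use comp ne in auto)
  then show "compact equivariant_tuples" "equivariant_tuples \<noteq> {}"
    by (simp_all add: eq)
qed

text \<open>Where \<open>f\<close> rises, the new factor is mapped to the next factor of the
  product. Where \<open>f\<close> repeats, it is mapped to the idempotent that ends the product so
  far, and is absorbed.\<close>

lemma equivariant_ascending:
  assumes u: "u \<in> equivariant_tuples" and idem: "\<And>j. ultra_mult merge (u j) (u j) = u j"
  shows "ascending_product (ultra_mult merge) u \<in> equivariant_tuples"
proof -
  let ?a = "ascending_product (ultra_mult merge) u"
  have u': "ultra (u j)" "u j (blocks m j)" "f \<in> collapse \<Longrightarrow> ultra_map (act f) (u j) = u (f j)"
    for f j m
    using u by (auto simp: equivariant_tuples_def)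
  have ultra: "ultra (?a j)" for j by (induction j) (simp_all add: u' ultra_ultra_mult)
  have "?a j (blocks m j)" for j m
  proof (induction j)
    case (Suc j)
    then have "ultra_mult merge (?a j) (u (Suc j)) (blocks m (Suc j))"
      using merge_blocks[of _ m j _ "Suc j"]
      by (intro ultra_mult_mem[of "?a j" "u (Suc j)" "blocks m j" "blocks m (Suc j)"]) (simp_all add: u' ultra)
    then show ?case by simp
  qed (simp add: u')
  moreover have absorb: "ultra_mult merge (?a j) (u j) = ?a j" for j
    by (cases j) (simp_all add: idem ultra_mult_merge_assoc)
  have "ultra_map (act f) (?a j) = ?a (f j)" if "f \<in> collapse" for f j
  proof (induction j)
    case 0
    have "f 0 = 0" using that by (simp add: collapse_def)
    with u'(3)[OF that, of 0] show ?case by simp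
  next
    case (Suc j)
    have "f (Suc j) = f j \<or> f (Suc j) = Suc (f j)" using that by (simp add: collapse_def)
    then show ?case
      using that Suc u'(3)[OF that, of "Suc j"] by (auto simp: ultra_map_mult act_merge absorb)
  qed
  ultimately show ?thesis by (simp add: equivariant_tuples_def ultra)
qed

text \<open>Mirror image of the ascending case: a repeated idempotent is absorbed at the
  front.\<close>

lemma equivariant_descending:
  assumes u: "u \<in> equivariant_tuples" and idem: "\<And>j. ultra_mult merge (u j) (u j) = u j"
  shows "descending_product (ultra_mult merge) u \<in> equivariant_tuples"
proof -
  let ?a = "descending_product (ultra_mult merge) u"
  have u': "ultra (u j)" "u j (blocks m j)" "f \<in> collapse \<Longrightarrow> ultra_map (act f) (u j) = u (f j)"
    for f j m
    using u by (auto simp: equivariant_tuples_def)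
  have ultra: "ultra (?a j)" for j by (induction j) (simp_all add: u' ultra_ultra_mult)
  have "?a j (blocks m j)" for j m
  proof (induction j)
    case (Suc j)
    then have "ultra_mult merge (u (Suc j)) (?a j) (blocks m (Suc j))"
      using merge_blocks[of _ m "Suc j" _ j]
      by (intro ultra_mult_mem[of "u (Suc j)" "?a j" "blocks m (Suc j)" "blocks m j"]) (simp_all add: u' ultra)
    then show ?case by simp
  qed (simp add: u')
  moreover have absorb: "ultra_mult merge (u j) (?a j) = ?a j" for j
    by (cases j) (simp_all add: idem ultra_mult_merge_assoc[symmetric])
  have "ultra_map (act f) (?a j) = ?a (f j)" if "f \<in> collapse" for f j
  proof (induction j)
    case 0
    have "f 0 = 0" using that by (simp add: collapse_def)
    with u'(3)[OF that, of 0] show ?case by simp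
  next
    case (Suc j)
    have "f (Suc j) = f j \<or> f (Suc j) = Suc (f j)" using that by (simp add: collapse_def)
    then show ?case
      using that Suc u'(3)[OF that, of "Suc j"] by (auto simp: ultra_map_mult act_merge absorb)
  qed
  ultimately show ?thesis by (simp add: equivariant_tuples_def ultra)
qed

lemma absorbing_equivariant_tuple:
  "\<exists>u\<in>equivariant_tuples. \<forall>i\<le>K. \<forall>j\<le>K. ultra_mult merge (u i) (u j) = u (max i j)"
proof (rule absorbing_tuple_exists)
  fix u v assume uv: "u \<in> equivariant_tuples" "v \<in> equivariant_tuples"
  have "ultra_mult merge (u j) (v j) (blocks m j)" for j m
  proof (rule ultra_mult_mem)
    show "ultra (u j)" "ultra (v j)" "u j (blocks m j)" "v j (blocks m j)"
      using uv by (auto simp: equivariant_tuples_def)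
  qed (use merge_blocks[of _ m j _ j] in simp)
  then show "(\<lambda>j. ultra_mult merge (u j) (v j)) \<in> equivariant_tuples"
    using uv by (simp add: equivariant_tuples_def ultra_ultra_mult ultra_map_mult act_merge)
next
  show "continuous_on UNIV (\<lambda>u. ultra_mult merge u v)" for v
    by (rule continuous_on_ultra_mult)
next
  show "compact equivariant_tuples" "equivariant_tuples \<noteq> {}"
    by (fact compact_equivariant_tuples)+
next
  fix u assume "u \<in> equivariant_tuples" "\<And>j. ultra_mult merge (u j) (u j) = u j"
  then show "ascending_product (ultra_mult merge) u \<in> equivariant_tuples"
    "descending_product (ultra_mult merge) u \<in> equivariant_tuples"
    by (fact equivariant_ascending, fact equivariant_descending)
qed (rule ultra_mult_merge_assoc)

section \<open>The partition theorem for a path\<close>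

primrec max_below :: "(nat \<Rightarrow> nat) \<Rightarrow> nat \<Rightarrow> nat" where
  "max_below g 0 = 0"
| "max_below g (Suc n) = max (max_below g n) (g n)"

text \<open>Total counterpart of a sum of transformed blocks; on disjoint supports at most one term
  is nonzero at each point.\<close>

definition merged :: "(nat \<Rightarrow> nat \<Rightarrow> nat) \<Rightarrow> (nat \<Rightarrow> nat \<Rightarrow> nat) \<Rightarrow> nat \<Rightarrow> nat \<Rightarrow> nat" where
  "merged f b n = (\<lambda>x. max_below (\<lambda>i. f i (b i x)) n)"

lemma merged_0: "merged f b 0 = (\<lambda>_. 0)"
  by (simp add: merged_def)

lemma merged_Suc: "merged f b (Suc n) = merge (merged f b n) (act (f n) (b n))"
  by (simp add: merged_def merge_def act_def)

lemma max_below_le_iff: "max_below g n \<le> k \<longleftrightarrow> (\<forall>i<n. g i \<le> k)"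
  by (induction n) (auto simp: less_Suc_eq)

lemma max_below_upper: "i < n \<Longrightarrow> g i \<le> max_below g n"
  using max_below_le_iff[of g n "max_below g n"] by blast

lemma max_below_eq_0_iff: "max_below g n = 0 \<longleftrightarrow> (\<forall>i<n. g i = 0)"
  using max_below_le_iff[of g n 0] by simp

text \<open>Turns a sum over selected blocks into one over an initial segment of all blocks, the
  others contributing 0.\<close>

lemma max_below_reindex:
  assumes "\<And>i. i \<le> l \<Longrightarrow> ns i < N \<and> h (ns i) = g i"
    and "\<And>m. m < N \<Longrightarrow> m \<notin> ns ` {..l} \<Longrightarrow> h m = 0"
  shows "max_below h N = max_below g (Suc l)"
proof (rule antisym)
  have "h m \<le> max_below g (Suc l)" if "m < N" for m
  proof (cases "m \<in> ns ` {..l}")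
    case True
    then obtain i where "i \<le> l" "m = ns i" by auto
    then show ?thesis using assms(1) max_below_upper[of i "Suc l" g] by simp
  qed (use assms(2) that in simp)
  then show "max_below h N \<le> max_below g (Suc l)" by (simp only: max_below_le_iff) blast
  have "g i \<le> max_below h N" if "i < Suc l" for i
    using assms(1)[of i] max_below_upper[of "ns i" N h] that by simp
  then show "max_below g (Suc l) \<le> max_below h N" by (simp only: max_below_le_iff) blast
qed

text \<open>Galvin-Glazer recursion: each block comes from a set in \<open>u K\<close> that keeps
  all sums good. \<open>N n\<close> bounds the supports of the blocks before
  \<open>n\<close>.\<close>

lemma path_partition:
  fixes c :: "(nat \<Rightarrow> nat) \<Rightarrow> 'k" and d :: "nat \<Rightarrow> nat"
  assumes fin: "finite (range c)"
  shows "\<exists>b N \<chi>. (\<forall>n. b n \<in> blocks (max (N n) (d n)) K) \<and>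
    (\<forall>n. N n \<le> N (Suc n)) \<and> (\<forall>n x. b n x \<noteq> 0 \<longrightarrow> x \<le> N (Suc n)) \<and>
    (\<forall>n f. (\<forall>i<n. f i \<in> collapse) \<longrightarrow> c (merged f b n) = \<chi> (max_below (\<lambda>i. f i K) n))"
proof -
  obtain u where u: "u \<in> equivariant_tuples"
    and abs: "\<And>i j. i \<le> K \<Longrightarrow> j \<le> K \<Longrightarrow> ultra_mult merge (u i) (u j) = u (max i j)"
    using absorbing_equivariant_tuple[of K] by blast
  have ultra: "ultra (u j)" and blk: "u j (blocks m j)" for j m
    using u by (simp_all add: equivariant_tuples_def)
  have equiv: "ultra_map (act f) (u j) = u (f j)" if "f \<in> collapse" for f j
    using u that by (simp add: equivariant_tuples_def)
  obtain \<chi> where \<chi>: "\<And>j. u j {x. c x = \<chi> j}"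
    using ultra_colour[OF ultra fin] by metis
  \<comment> \<open>Good sums of level \<open>j\<close>: the colour is right, and stays right after
    adding a \<open>u k\<close>-typical block, for every level \<open>k\<close> up to
    \<open>K\<close>.\<close>
  define G where "G j = {x. c x = \<chi> j \<and> (\<forall>k\<in>{..K}. u k {y. c (merge x y) = \<chi> (max j k)})}" for j
  \<comment> \<open>Absorption read on sets: typical blocks of levels \<open>j\<close> and
    \<open>k\<close> added in turn amount to one typical block of level
    \<open>max j k\<close>.\<close>
  have shift: "u j {x. u k {y. c (merge z (merge x y)) = a}} \<longleftrightarrow> u (max j k) {x. c (merge z x) = a}"
    if "j \<le> K" "k \<le> K" for j k z a
    using fun_cong[OF abs[OF that], of "{x. c (merge z x) = a}"] by (simp add: ultra_mult_def)
  have merge_0: "merge (\<lambda>_. 0) y = y" for y by (simp add: merge_def)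
  \<comment> \<open>\<open>u 0\<close> concentrates on the zero function, the empty sum from which
    the recursion starts.\<close>
  have G0: "(\<lambda>_. 0) \<in> G 0"
  proof -
    have "(\<lambda>_. 0) \<in> {x. c x = \<chi> 0}"
      using ultra_nonempty[OF ultra, of 0 "{\<lambda>_. 0} \<inter> {x. c x = \<chi> 0}"] ultra[of 0] \<chi>[of 0] blk[of 0]
      by (auto simp: ultra_def blocks_0)
    then show ?thesis by (simp add: G_def merge_0 \<chi>)
  qed
  have G_step: "u k {y. merge x y \<in> G (max j k)}" if "x \<in> G j" "j \<le> K" "k \<le> K" for x j k
  proof -
    have G: "u i {y. c (merge x y) = \<chi> (max j i)}" if "i \<le> K" for i
      using \<open>x \<in> G j\<close> that by (simp add: G_def)
    have "u k {y. u i {z. c (merge (merge x y) z) = \<chi> (max (max j k) i)}}" if "i \<in> {..K}" for i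
      using G[of "max k i"] that \<open>k \<le> K\<close> shift[of k i x] by (simp add: merge_assoc max.assoc)
    then have "u k {y. \<forall>i\<in>{..K}. u i {z. c (merge (merge x y) z) = \<chi> (max (max j k) i)}}"
      unfolding ultra_Collect_ball[OF ultra finite_atMost] by blast
    then show ?thesis
      using G[OF \<open>k \<le> K\<close>] by (simp add: G_def ultra_Collect_conj[OF ultra])
  qed
  define M where "M = {f \<in> collapse. \<forall>j\<ge>K. f j = f K}"
  have "finite M" unfolding M_def by (rule finite_collapse_bounded)
  have M_collapse: "f \<in> collapse" if "f \<in> M" for f using that by (simp add: M_def)
  have M_le: "f K \<le> K" if "f \<in> M" for f using collapse_le M_collapse that by blast
  \<comment> \<open>A state holds all sums so far, tagged with their levels, and a bound for the
    supports. The zero map lies in \<open>M\<close>, so sums omitting the new block are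
    kept.\<close>
  define next_sums where
    "next_sums X b = (\<lambda>((x, j), f). (merge x (act f b), max j (f K))) ` (X \<times> M)"
    for X :: "((nat \<Rightarrow> nat) \<times> nat) set" and b
  define good where "good X \<longleftrightarrow> finite X \<and> (\<forall>(x, j) \<in> X. j \<le> K \<and> x \<in> G j)" for X
  define step where "step n s s' \<longleftrightarrow> (\<exists>b. b \<in> blocks (max (snd s) (d n)) K \<and> snd s \<le> snd s' \<and>
      (\<forall>x. b x \<noteq> 0 \<longrightarrow> x \<le> snd s') \<and> fst s' = next_sums (fst s) b)"
    for n and s s' :: "((nat \<Rightarrow> nat) \<times> nat) set \<times> nat"
  have "\<exists>s. \<forall>n. (good (fst (s n)) \<and> (n = 0 \<longrightarrow> fst (s n) = {(\<lambda>_. 0, 0)})) \<and> step n (s n) (s (Suc n))"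
  proof (rule dependent_nat_choice)
    have "good {(\<lambda>_. 0, 0)}" by (simp add: good_def G0)
    then show "\<exists>s. good (fst s) \<and> (0 = (0::nat) \<longrightarrow> fst s = {(\<lambda>_. 0, 0)})"
      by (metis fst_conv)
  next
    fix s :: "((nat \<Rightarrow> nat) \<times> nat) set \<times> nat" and n :: nat
    assume "good (fst s) \<and> (n = 0 \<longrightarrow> fst s = {(\<lambda>_. 0, 0)})"
    then have X: "finite (fst s)" "\<And>x j. (x, j) \<in> fst s \<Longrightarrow> j \<le> K \<and> x \<in> G j"
      by (auto simp: good_def)
    define P where "P = (\<lambda>((x, j), f) b. merge x (act f b) \<in> G (max j (f K)))"
    \<comment> \<open>By equivariance \<open>act f\<close> carries \<open>u K\<close> to
      \<open>u (f K)\<close>, so \<open>G_step\<close> at level \<open>f K\<close> becomes a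
      condition on \<open>b\<close> that holds \<open>u K\<close>-typically.\<close>
    have "u K {b. P p b}" if "p \<in> fst s \<times> M" for p
    proof -
      obtain x j f where "p = ((x, j), f)" by (metis surj_pair)
      then have p: "p = ((x, j), f)" "(x, j) \<in> fst s" "f \<in> M" using that by auto
      have "u (f K) {y. merge x y \<in> G (max j (f K))}"
        using G_step X(2)[OF p(2)] M_le[OF p(3)] by blast
      then show ?thesis
        using fun_cong[OF equiv[OF M_collapse[OF p(3)], of K], of "{y. merge x y \<in> G (max j (f K))}"]
        by (simp add: p(1) P_def ultra_map_def)
    qed
    then have "u K {b. \<forall>p\<in>fst s \<times> M. P p b}"
      using ultra_Collect_ball[OF ultra, of "fst s \<times> M"] X(1) \<open>finite M\<close> by blast
    then have "u K (blocks (max (snd s) (d n)) K \<inter> {b. \<forall>p\<in>fst s \<times> M. P p b})"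
      using ultra[of K] blk by (simp add: ultra_def)
    then obtain b where b: "b \<in> blocks (max (snd s) (d n)) K" "\<And>p. p \<in> fst s \<times> M \<Longrightarrow> P p b"
      using ultra_nonempty[OF ultra] by blast
    have "finite {x. b x \<noteq> 0}" using b(1) by (simp add: blocks_def)
    then obtain N where N: "\<And>x. b x \<noteq> 0 \<Longrightarrow> x \<le> N"
      by (auto simp: finite_nat_set_iff_bounded_le)
    have "good (next_sums (fst s) b)"
      using X b(2) \<open>finite M\<close> M_le by (fastforce simp: good_def next_sums_def P_def)
    moreover have "step n s (next_sums (fst s) b, max N (snd s))"
      using b(1) N by (auto simp: step_def le_max_iff_disj intro!: exI[of _ b])
    ultimately show "\<exists>s'. (good (fst s') \<and> (Suc n = 0 \<longrightarrow> fst s' = {(\<lambda>_. 0, 0)})) \<and> step n s s'"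
      by (intro exI[of _ "(next_sums (fst s) b, max N (snd s))"]) simp
  qed
  then obtain s where good: "\<And>n. good (fst (s n))" and s0: "fst (s 0) = {(\<lambda>_. 0, 0)}"
    and st: "\<And>n. step n (s n) (s (Suc n))" by blast
  obtain b where b: "\<And>n. b n \<in> blocks (max (snd (s n)) (d n)) K"
    and le: "\<And>n. snd (s n) \<le> snd (s (Suc n))"
    and supp: "\<And>n x. b n x \<noteq> 0 \<Longrightarrow> x \<le> snd (s (Suc n))"
    and sums: "\<And>n. fst (s (Suc n)) = next_sums (fst (s n)) (b n)"
    using st unfolding step_def by metis
  have mem: "(merged f b n, max_below (\<lambda>i. f i K) n) \<in> fst (s n)" if "\<forall>i<n. f i \<in> collapse" for f n
    using that
  proof (induction n)
    case 0
    then show ?case by (simp add: s0 merged_0)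
  next
    case (Suc n)
    \<comment> \<open>Freezing \<open>f n\<close> above \<open>K\<close> puts it into
      \<open>M\<close> without changing its action on \<open>b n\<close>, whose values are at most
      \<open>K\<close>.\<close>
    define g where "g j = f n (min j K)" for j
    have "g \<in> collapse" unfolding g_def using Suc.prems by (intro collapse_min) simp
    then have "g \<in> M" by (simp add: M_def g_def)
    moreover have "act (f n) (b n) = act g (b n)"
      using b[of n] by (simp add: act_def g_def blocks_def)
    moreover have "f n K = g K" by (simp add: g_def)
    ultimately show ?case
      using Suc unfolding sums next_sums_def merged_Suc max_below.simps
      by (intro image_eqI[of _ _ "((merged f b n, max_below (\<lambda>i. f i K) n), g)"]) auto
  qed
  have "x \<in> G j" if "(x, j) \<in> fst (s n)" for x j n
    using good[of n] that by (auto simp: good_def)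
  from this[OF mem]
  have "c (merged f b n) = \<chi> (max_below (\<lambda>i. f i K) n)" if "\<forall>i<n. f i \<in> collapse" for f n
    using that by (simp add: G_def)
  then show ?thesis
    using b le supp by (intro exI[of _ b] exI[of _ "\<lambda>n. snd (s n)"] exI[of _ \<chi>]) auto
qed

section \<open>Trees\<close>

locale rooted_tree =
  fixes T :: "'a set" and r :: 'a and E :: "('a \<times> 'a) set"
  assumes tree: "finite_rooted_tree T r E"
begin

section \<open>Depths and ancestors\<close>

definition depth :: "'a \<Rightarrow> nat" where
  "depth t = (LEAST n. (t, r) \<in> E ^^ n)"

text \<open>Indexed by absolute depth, so that comparable nodes share their common ancestors under
  the same index.\<close>

definition ancestor :: "'a \<Rightarrow> nat \<Rightarrow> 'a" where
  "ancestor t j = (THE s. (t, s) \<in> E ^^ (depth t - j))"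

lemma root_in: "r \<in> T"
  using tree by (simp add: finite_rooted_tree_def)

lemma edge_in: "(s, t) \<in> E \<Longrightarrow> s \<in> T \<and> t \<in> T"
  using tree by (auto simp: finite_rooted_tree_def)

lemma root_no_parent: "(r, p) \<notin> E"
  using tree by (simp add: finite_rooted_tree_def)

lemma parent_unique: "(t, p) \<in> E \<Longrightarrow> (t, q) \<in> E \<Longrightarrow> p = q"
  using tree edge_in root_no_parent unfolding finite_rooted_tree_def by (metis DiffI singletonD)

lemma relpow_unique: "(t, s) \<in> E ^^ n \<Longrightarrow> (t, s') \<in> E ^^ n \<Longrightarrow> s = s'"
proof (induction n arbitrary: s s')
  case (Suc n)
  then show ?case by (auto dest: parent_unique)
qed simp

lemma relpow_in: "(t, s) \<in> E ^^ n \<Longrightarrow> t \<in> T \<Longrightarrow> s \<in> T"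
  by (cases n) (auto dest: edge_in)

lemma relpow_root: "(r, s) \<in> E ^^ n \<Longrightarrow> n = 0"
  using root_no_parent by (metis relpow_E2)

text \<open>Parents are unique, so a longer path to the root would extend a shorter one and leave
  the root, which has no parent.\<close>

lemma depth_eqI:
  assumes "(t, r) \<in> E ^^ n"
  shows "depth t = n"
  unfolding depth_def
proof (rule Least_equality)
  fix m assume m: "(t, r) \<in> E ^^ m"
  show "n \<le> m"
  proof (rule ccontr)
    assume "\<not> n \<le> m"
    then have "(t, r) \<in> E ^^ m O E ^^ (n - m)"
      using assms by (simp flip: relpow_add)
    then obtain s where "(t, s) \<in> E ^^ m" "(s, r) \<in> E ^^ (n - m)" by auto
    then have "n - m = 0" using relpow_unique[OF m] relpow_root by blast
    with \<open>\<not> n \<le> m\<close> show False by simp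
  qed
qed (fact assms)

lemma relpow_depth:
  assumes "t \<in> T"
  shows "(t, r) \<in> E ^^ depth t"
proof -
  have "(t, r) \<in> E\<^sup>*" using assms tree by (simp add: finite_rooted_tree_def)
  then obtain n where "(t, r) \<in> E ^^ n" by (auto simp: rtrancl_power)
  then show ?thesis using depth_eqI by blast
qed

lemma depth_relpow:
  assumes "t \<in> T" "(t, s) \<in> E ^^ m"
  shows "depth t = m + depth s"
proof (rule depth_eqI)
  have "(s, r) \<in> E ^^ depth s" using assms relpow_in relpow_depth by blast
  then show "(t, r) \<in> E ^^ (m + depth s)" using assms(2) by (auto simp: relpow_add)
qed

lemma depth_eq_0_iff: "t \<in> T \<Longrightarrow> depth t = 0 \<longleftrightarrow> t = r"
  using relpow_depth[of t] depth_eqI[of r 0] by auto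

lemma ancestor_eqI: "(t, s) \<in> E ^^ (depth t - j) \<Longrightarrow> ancestor t j = s"
  unfolding ancestor_def using relpow_unique by blast

lemma
  assumes "t \<in> T" "j \<le> depth t"
  shows relpow_ancestor: "(t, ancestor t j) \<in> E ^^ (depth t - j)"
    and depth_ancestor: "depth (ancestor t j) = j"
proof -
  have "(t, r) \<in> E ^^ (depth t - j) O E ^^ j"
    using relpow_depth[OF assms(1)] assms(2) by (simp flip: relpow_add)
  then obtain s where s: "(t, s) \<in> E ^^ (depth t - j)" "(s, r) \<in> E ^^ j" by auto
  then show "(t, ancestor t j) \<in> E ^^ (depth t - j)" "depth (ancestor t j) = j"
    using ancestor_eqI depth_eqI by auto
qed

lemma ancestor_in: "t \<in> T \<Longrightarrow> j \<le> depth t \<Longrightarrow> ancestor t j \<in> T"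
  using relpow_ancestor relpow_in by blast

lemma tree_le_ancestor: "t \<in> T \<Longrightarrow> j \<le> depth t \<Longrightarrow> tree_le E t (ancestor t j)"
  using relpow_ancestor unfolding tree_le_def by (blast intro: relpow_imp_rtrancl)

lemma tree_le_trans: "tree_le E s t \<Longrightarrow> tree_le E t u \<Longrightarrow> tree_le E s u"
  by (simp add: tree_le_def)

lemma tree_le_imp:
  assumes "t \<in> T" "tree_le E t s"
  shows "s \<in> T" "depth s \<le> depth t" "ancestor t (depth s) = s"
proof -
  obtain m where m: "(t, s) \<in> E ^^ m" using assms(2) by (auto simp: tree_le_def rtrancl_power)
  show "s \<in> T" "depth s \<le> depth t" "ancestor t (depth s) = s"
    using depth_relpow[OF assms(1) m] relpow_in[OF m assms(1)] m by (auto intro: ancestor_eqI)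
qed

lemma ancestor_tree_le:
  assumes "t \<in> T" "tree_le E t s" "j \<le> depth s"
  shows "ancestor t j = ancestor s j"
proof -
  have s: "s \<in> T" using assms tree_le_imp by blast
  have "tree_le E t (ancestor s j)"
    using tree_le_trans[OF assms(2) tree_le_ancestor[OF s assms(3)]] .
  then show ?thesis using tree_le_imp(3)[OF assms(1)] depth_ancestor[OF s assms(3)] by metis
qed

lemma ancestor_0: "t \<in> T \<Longrightarrow> ancestor t 0 = r"
  using relpow_depth by (intro ancestor_eqI) simp

lemma ancestor_depth: "ancestor t (depth t) = t"
  by (rule ancestor_eqI) simp

lemma ancestor_mono:
  assumes "t \<in> T" "i \<le> j" "j \<le> depth t"
  shows "tree_le E (ancestor t j) (ancestor t i)"
  using assms ancestor_tree_le[OF assms(1) tree_le_ancestor[OF assms(1,3)], of i]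
    tree_le_ancestor[OF ancestor_in[OF assms(1,3)], of i]
  by (simp add: depth_ancestor)

lemma ancestor_Suc:
  assumes "t \<in> T" "Suc j \<le> depth t"
  shows "(ancestor t (Suc j), ancestor t j) \<in> E"
proof -
  let ?s = "ancestor t (Suc j)"
  have s: "?s \<in> T" "depth ?s = Suc j" using assms by (auto simp: ancestor_in depth_ancestor)
  then have "(?s, ancestor ?s j) \<in> E ^^ Suc 0" using relpow_ancestor[of ?s j] by simp
  moreover have "ancestor t j = ancestor ?s j"
    using s by (intro ancestor_tree_le[OF assms(1) tree_le_ancestor[OF assms]]) simp
  ultimately show ?thesis by simp
qed

lemma depth_edge: "(s, t) \<in> E \<Longrightarrow> depth s = Suc (depth t)"
  using depth_relpow[of s t 1] edge_in by auto

section \<open>Copies of blocks on the paths of the tree\<close>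

definition lift :: "'a \<Rightarrow> (nat \<Rightarrow> nat) \<Rightarrow> nat \<rightharpoonup> 'a" where
  "lift t b = (\<lambda>x. if b x = 0 then None else Some (ancestor t (b x)))"

lemma dom_lift: "dom (lift t b) = {x. b x \<noteq> 0}"
  by (auto simp: lift_def dom_def)

lemma ran_lift: "ran (lift t b) = ancestor t ` (b ` {x. b x \<noteq> 0})"
  by (auto simp: lift_def ran_def)

lemma ancestors_chain:
  assumes "t \<in> T" "J \<subseteq> {..depth t}"
  shows "tree_chain T E (ancestor t ` J)"
  unfolding pred_on.chain_def
proof (intro conjI ballI)
  fix x y assume "x \<in> ancestor t ` J" "y \<in> ancestor t ` J"
  then obtain i j where "x = ancestor t i" "y = ancestor t j" "i \<le> depth t" "j \<le> depth t"
    using assms by auto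
  then show "(tree_le E)\<^sup>=\<^sup>= x y \<or> (tree_le E)\<^sup>=\<^sup>= y x"
    using ancestor_mono[OF assms(1)] nat_le_linear[of i j] by blast
qed (use assms ancestor_in in auto)

lemma chain_subset_branch:
  assumes "tree_chain T E C"
  shows "\<exists>B. branch T E B \<and> C \<subseteq> B"
proof -
  let ?A = "{C. tree_chain T E C}"
  have "finite T" using tree by (simp add: finite_rooted_tree_def)
  then have "finite ?A"
    by (rule finite_subset[rotated, OF finite_Pow_iff[THEN iffD2]]) (auto simp: pred_on.chain_def)
  then obtain B where "B \<in> ?A" "C \<subseteq> B" "\<forall>D\<in>?A. B \<subseteq> D \<longrightarrow> B = D"
    using finite_has_maximal2[of ?A C] assms by blast
  then show ?thesis by (auto simp: pred_on.maxchain_def intro!: exI[of _ B])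
qed

lemma lift_in_FIN:
  assumes "t \<in> T" "finite {x. b x \<noteq> 0}" "\<And>x. b x \<le> depth t"
  shows "lift t b \<in> FIN T r E"
proof -
  have "tree_chain T E (ran (lift t b))"
    unfolding ran_lift using assms by (intro ancestors_chain) auto
  moreover have "ran (lift t b) \<subseteq> T - {r}"
  proof
    fix s assume "s \<in> ran (lift t b)"
    then obtain x where "s = ancestor t (b x)" "b x \<noteq> 0" by (auto simp: ran_lift)
    then show "s \<in> T - {r}"
      using assms(1,3) ancestor_in depth_ancestor depth_eq_0_iff root_in by (metis DiffI singletonD)
  qed
  ultimately show ?thesis
    using assms(2) chain_subset_branch by (simp add: FIN_def dom_lift)
qed

lemma lift_in_FIN_at:
  assumes "t \<in> T" "finite {x. b x \<noteq> 0}" "\<And>x. b x \<le> depth t" "b y = depth t"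
  shows "lift t b \<in> FIN_at T r E t"
proof (cases "t = r")
  case True
  then have "lift t b = Map.empty"
    using assms depth_eq_0_iff[of t] by (auto simp: lift_def)
  then show ?thesis using True by (simp add: FIN_at_def)
next
  case False
  have "tree_chain T E (ran (lift t b))"
    unfolding ran_lift using assms by (intro ancestors_chain) auto
  moreover have "t \<in> ran (lift t b)"
    using assms False depth_eq_0_iff[of t] unfolding ran_lift
    by (auto intro!: image_eqI[of t _ "b y"] simp: ancestor_depth)
  moreover have "tree_le E t s" if "s \<in> ran (lift t b)" for s
    using that assms tree_le_ancestor by (auto simp: ran_lift)
  ultimately show ?thesis
    using lift_in_FIN[OF assms(1-3)] False by (simp add: FIN_at_def chain_with_least_def)
qed

text \<open>Allows all summands to be rewritten as copies at the least node of the chain.\<close>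

lemma lift_tree_le:
  assumes "t \<in> T" "tree_le E t s" "\<And>x. b x \<le> depth s"
  shows "lift s b = lift t b"
  using ancestor_tree_le[OF assms(1,2)] assms(3) by (auto simp: lift_def)

text \<open>Frozen beyond the depth of \<open>t\<close>, where the path ends, to give a collapsing
  map on all of \<open>nat\<close>.\<close>

definition path_map :: "('a \<Rightarrow> 'a) \<Rightarrow> 'a \<Rightarrow> nat \<Rightarrow> nat" where
  "path_map f t j = depth (f (ancestor t (min j (depth t))))"

lemma path_map_depth: "depth t \<le> j \<Longrightarrow> path_map f t j = depth (f t)"
  by (simp add: path_map_def ancestor_depth min_absorb2)

lemma regressive_homD:
  assumes "regressive_hom T E f" "t \<in> T"
  shows "f t \<in> T" "tree_le E t (f t)" "depth (f t) \<le> depth t"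
    "j \<le> depth t \<Longrightarrow> tree_le E (f t) (f (ancestor t j))"
  using assms tree_le_imp(2) tree_le_ancestor ancestor_in
  by (auto simp: regressive_hom_def)

text \<open>Regressiveness fixes the root. Along an edge, order preservation keeps the image depth
  from dropping away from the root, and adjacency limits its growth to one.\<close>

lemma path_map_collapse:
  assumes f: "regressive_hom T E f" and t: "t \<in> T"
  shows "path_map f t \<in> collapse"
proof -
  have "path_map f t 0 = 0"
    using regressive_homD(3)[OF f root_in] t depth_eq_0_iff[OF root_in]
    by (simp add: path_map_def ancestor_0)
  moreover have "path_map f t (Suc n) = path_map f t n \<or> path_map f t (Suc n) = Suc (path_map f t n)" for n
  proof (cases "Suc n \<le> depth t")
    case True
    let ?a = "ancestor t (Suc n)" and ?b = "ancestor t n"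
    have E: "(?a, ?b) \<in> E" using ancestor_Suc[OF t True] .
    then have T: "?a \<in> T" "?b \<in> T" using edge_in by auto
    have "tree_le E ?a ?b" using E by (auto simp: tree_le_def)
    then have "tree_le E (f ?a) (f ?b)" using f T by (simp add: regressive_hom_def)
    then have le: "depth (f ?b) \<le> depth (f ?a)" using tree_le_imp(2) regressive_homD(1)[OF f] T by blast
    have "f ?a = f ?b \<or> adjacent E (f ?a) (f ?b)"
      using f T E by (auto simp: regressive_hom_def adjacent_def)
    then have "depth (f ?a) = depth (f ?b) \<or> depth (f ?a) = Suc (depth (f ?b))"
      using le depth_edge by (fastforce simp: adjacent_def)
    then show ?thesis using True by (simp add: path_map_def min_absorb1)
  qed (simp add: path_map_depth)
  ultimately show ?thesis by (simp add: collapse_def)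
qed

text \<open>By order preservation \<open>f\<close> sends ancestors of \<open>t\<close> to ancestors
  of \<open>f t\<close>, which are determined by their depths. Images equal to the root have depth 0
  and are dropped on both sides.\<close>

lemma tau_lift:
  assumes f: "regressive_hom T E f" and t: "t \<in> T" and b: "\<And>x. b x \<le> depth t"
  shows "tau T r f (lift t b) = lift (f t) (act (path_map f t) b)"
proof
  fix x
  let ?s = "ancestor t (b x)"
  have s: "?s \<in> T" using ancestor_in t b by blast
  then have fs: "f ?s \<in> T" using regressive_homD(1) f by blast
  have pm: "path_map f t (b x) = depth (f ?s)" using b by (simp add: path_map_def min_absorb1)
  have "ancestor (f t) (depth (f ?s)) = f ?s"
    using tree_le_imp(3) regressive_homD[OF f t] b by blast
  moreover have "path_map f t 0 = 0" using path_map_collapse[OF f t] by (simp add: collapse_def)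
  ultimately show "tau T r f (lift t b) x = lift (f t) (act (path_map f t) b) x"
    using pm fs depth_eq_0_iff[OF fs] by (auto simp: tau_def lift_def act_def)
qed

text \<open>With disjoint supports, the maximum selects the only nonzero term, exactly as the union
  of maps does.\<close>

lemma fin_sum_lift:
  assumes "\<And>i j x. i < j \<Longrightarrow> j < n \<Longrightarrow> g i x = 0 \<or> g j x = 0"
  shows "fin_sum (map (\<lambda>i. lift t (g i)) [0..<n]) = Some (lift t (\<lambda>x. max_below (\<lambda>i. g i x) n))"
  using assms
proof (induction n)
  case 0
  then show ?case by (simp add: fin_sum_def lift_def)
next
  case (Suc n)
  have disj: "max_below (\<lambda>i. g i x) n = 0 \<or> g n x = 0" for x
    using Suc.prems[of _ n x] by (auto simp: max_below_eq_0_iff)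
  have "lift t (\<lambda>x. max_below (\<lambda>i. g i x) n) ++ lift t (g n)
      = lift t (\<lambda>x. max_below (\<lambda>i. g i x) (Suc n))"
  proof
    fix x
    show "(lift t (\<lambda>x. max_below (\<lambda>i. g i x) n) ++ lift t (g n)) x
      = lift t (\<lambda>x. max_below (\<lambda>i. g i x) (Suc n)) x"
      using disj[of x] by (auto simp: map_add_def lift_def)
  qed
  moreover have "dom (lift t (\<lambda>x. max_below (\<lambda>i. g i x) n)) \<inter> dom (lift t (g n)) = {}"
    unfolding dom_lift disjoint_iff mem_Collect_eq using disj by metis
  moreover have "fin_sum (map (\<lambda>i. lift t (g i)) [0..<Suc n])
      = Option.bind (fin_sum (map (\<lambda>i. lift t (g i)) [0..<n])) (\<lambda>s. fin_plus s (lift t (g n)))"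
    by (simp add: fin_sum_def)
  ultimately show ?case using Suc by (simp add: fin_plus_def)
qed

end

section \<open>Transfer from the path to the tree\<close>

theorem theorem4p1:
  fixes T :: "'a set" and r :: 'a and E :: "('a \<times> 'a) set"
    and c :: "(nat \<rightharpoonup> 'a) \<Rightarrow> 'k" and d :: "nat \<Rightarrow> nat"
  assumes "finite_rooted_tree T r E"
    and "finite (c ` FIN T r E)"
  shows "\<exists>b :: 'a \<Rightarrow> nat \<Rightarrow> (nat \<rightharpoonup> 'a).
      (\<forall>t \<in> T. \<forall>n. b t n \<in> FIN_at T r E t) \<and>
      (\<forall>t \<in> T. \<forall>n. (\<forall>m \<in> dom (b t n). m > d n) \<and>
                    set_less (dom (b t n)) (dom (b t (Suc n)))) \<and>
      (\<exists>\<chi> :: 'a \<Rightarrow> 'k. \<forall>(l :: nat) (ns :: nat \<Rightarrow> nat) (ts :: nat \<Rightarrow> 'a) (f :: nat \<Rightarrow> 'a \<Rightarrow> 'a) t.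
         strict_mono_on {..l} ns \<longrightarrow>
         (\<forall>i \<le> l. ts i \<in> T) \<longrightarrow>
         (\<forall>i \<le> l. regressive_hom T E (f i)) \<longrightarrow>
         chain_with_least T E ((\<lambda>i. f i (ts i)) ` {..l}) t \<longrightarrow>
         (\<exists>s \<in> FIN T r E.
            fin_sum (map (\<lambda>i. tau T r (f i) (b (ts i) (ns i))) [0..<Suc l]) = Some s \<and>
            c s = \<chi> t))"
proof -
  interpret rooted_tree T r E by unfold_locales (fact assms(1))
  define K where "K = Max (depth ` T)"
  have "finite T" using assms(1) by (simp add: finite_rooted_tree_def)
  then have depth_K: "depth t \<le> K" if "t \<in> T" for t using that by (simp add: K_def)
  \<comment> \<open>One colour records the colours of all copies. The default
    \<open>Map.empty\<close> keeps it finite-valued when a copy is not in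
    \<open>FIN\<close>.\<close>
  define c' where
    "c' y = (\<lambda>t\<in>T. c (if lift t y \<in> FIN T r E then lift t y else Map.empty))" for y
  have "Map.empty \<in> FIN T r E"
    using lift_in_FIN[OF root_in, of "\<lambda>_. 0"] by (simp add: lift_def)
  then have "range c' \<subseteq> T \<rightarrow>\<^sub>E c ` FIN T r E" by (auto simp: c'_def)
  then have "finite (range c')"
    using finite_PiE[of T "\<lambda>_. c ` FIN T r E"] \<open>finite T\<close> assms(2) finite_subset by blast
  from path_partition[OF this, of d K] obtain b N \<chi> where
    b: "\<And>n. b n \<in> blocks (max (N n) (d n)) K" and N: "\<And>n. N n \<le> N (Suc n)"
    and supp: "\<And>n x. b n x \<noteq> 0 \<Longrightarrow> x \<le> N (Suc n)"
    and colour: "\<And>n f. \<forall>i<n. f i \<in> collapse \<Longrightarrow> c' (merged f b n) = \<chi> (max_below (\<lambda>i. f i K) n)"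
    by blast
  have b_le: "b n x \<le> K" and b_fin: "finite {x. b n x \<noteq> 0}" for n x
    using b[of n] by (auto simp: blocks_def)
  have b_lower: "N n < x" "d n < x" if "b n x \<noteq> 0" for n x
  proof -
    have "\<not> x \<le> max (N n) (d n)" using b[of n] that by (auto simp: blocks_def)
    then show "N n < x" "d n < x" by auto
  qed
  have b_less: "x < y" if "b m x \<noteq> 0" "b n y \<noteq> 0" "m < n" for m n x y
  proof -
    have "N (Suc m) \<le> N n" by (rule lift_Suc_mono_le[of N, OF N]) (use that(3) in simp)
    then show ?thesis using supp[OF that(1)] b_lower(1)[OF that(2)] by simp
  qed
  \<comment> \<open>Truncated subtraction is itself a collapsing map; it takes the top level
    \<open>K\<close> to the depth of \<open>t\<close>.\<close>
  define sh where "sh t j = j - (K - depth t)" for t j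
  have sh_collapse: "sh t \<in> collapse" for t
    unfolding collapse_def sh_def by auto
  have sh_le: "sh t j \<le> depth t" if "j \<le> K" for t j
    using that by (simp add: sh_def)
  have sh_K: "sh t K = depth t" if "t \<in> T" for t
    using depth_K[OF that] by (simp add: sh_def)
  define B where "B t n = lift t (act (sh t) (b n))" for t n
  have dom_B: "x \<in> dom (B t n) \<Longrightarrow> b n x \<noteq> 0" for t n x
    by (auto simp: B_def dom_lift act_def sh_def)
  have B_FIN_at: "B t n \<in> FIN_at T r E t" if t: "t \<in> T" for t n
  proof -
    obtain y where "b n y = K" using b[of n] by (auto simp: blocks_def)
    moreover have "finite {x. act (sh t) (b n) x \<noteq> 0}"
      by (rule finite_subset[OF _ b_fin[of n]]) (auto simp: act_def sh_def)
    ultimately show ?thesis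
      unfolding B_def using t by (intro lift_in_FIN_at[of t _ y]) (auto simp: act_def sh_K sh_le b_le)
  qed
  have sums: "\<exists>s \<in> FIN T r E.
      fin_sum (map (\<lambda>i. tau T r (f i) (B (ts i) (ns i))) [0..<Suc l]) = Some s \<and> c s = \<chi> (depth t) t"
    if ns: "strict_mono_on {..l} ns" and ts: "\<And>i. i \<le> l \<Longrightarrow> ts i \<in> T"
      and f: "\<And>i. i \<le> l \<Longrightarrow> regressive_hom T E (f i)"
      and least: "chain_with_least T E ((\<lambda>i. f i (ts i)) ` {..l}) t"
    for l ns ts f t
  proof -
    have le: "tree_le E t (f i (ts i))" if "i \<le> l" for i
      using least that by (auto simp: chain_with_least_def)
    obtain i0 where i0: "i0 \<le> l" "t = f i0 (ts i0)"
      using least by (auto simp: chain_with_least_def)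
    have t: "t \<in> T" using i0 f ts regressive_homD(1) by blast
    \<comment> \<open>Shifting to the depth of \<open>ts i\<close> and then applying
      \<open>f i\<close> is a single collapsing map on the original block.\<close>
    define G where "G i j = path_map (f i) (ts i) (sh (ts i) j)" for i j
    have G_collapse: "G i \<in> collapse" if "i \<le> l" for i
    proof -
      have "path_map (f i) (ts i) \<in> collapse" using that f ts by (intro path_map_collapse) auto
      then show ?thesis unfolding G_def using sh_collapse by (rule collapse_compose)
    qed
    have G_K: "G i K = depth (f i (ts i))" if "i \<le> l" for i
      using ts[OF that] by (simp add: G_def sh_K path_map_depth)
    have G_le: "G i j \<le> depth t" if "i \<le> l" "j \<le> K" for i j
      using collapse_mono[OF G_collapse that(2)] G_K tree_le_imp(2)[OF t le] that(1) by fastforce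
    have summand: "tau T r (f i) (B (ts i) (ns i)) = lift t (act (G i) (b (ns i)))" if "i \<le> l" for i
    proof -
      have "tau T r (f i) (B (ts i) (ns i))
        = lift (f i (ts i)) (act (path_map (f i) (ts i)) (act (sh (ts i)) (b (ns i))))"
        unfolding B_def using that f ts by (intro tau_lift) (auto simp: act_def sh_le b_le)
      also have "act (path_map (f i) (ts i)) (act (sh (ts i)) (b (ns i))) = act (G i) (b (ns i))"
        by (simp add: act_def G_def)
      also have "lift (f i (ts i)) (act (G i) (b (ns i))) = lift t (act (G i) (b (ns i)))"
        using collapse_mono[OF G_collapse[OF that] b_le] G_K[OF that]
        by (intro lift_tree_le t le that) (simp add: act_def)
      finally show ?thesis .
    qed
    \<comment> \<open>Missing indices receive the zero map, since \<open>colour\<close> needs a map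
      at every index below \<open>M\<close>.\<close>
    define F where "F m = (if m \<in> ns ` {..l} then G (inv_into {..l} ns m) else (\<lambda>_. 0))" for m
    define M where "M = Suc (ns l)"
    have inj: "inj_on ns {..l}" using ns by (rule strict_mono_on_imp_inj_on)
    have F_ns: "F (ns i) = G i" if "i \<le> l" for i
      using that inv_into_f_f[OF inj, of i] by (simp add: F_def)
    have F_out: "F m = (\<lambda>_. 0)" if "m \<notin> ns ` {..l}" for m
      using that by (simp add: F_def)
    have ns_M: "ns i < M" if "i \<le> l" for i
      using strict_mono_on_leD[OF ns, of i l] that by (simp add: M_def)
    have F_collapse: "F m \<in> collapse" for m
    proof (cases "m \<in> ns ` {..l}")
      case True
      then show ?thesis using F_ns G_collapse by auto
    qed (simp add: F_out collapse_def)
    define y where "y = merged F b M"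
    have y: "y = (\<lambda>x. max_below (\<lambda>i. act (G i) (b (ns i)) x) (Suc l))"
      unfolding y_def merged_def
      by (intro ext max_below_reindex[of l ns]) (auto simp: F_ns F_out act_def ns_M)
    have y_le: "y x \<le> depth t" for x
      unfolding y max_below_le_iff using G_le b_le by (simp add: act_def)
    \<comment> \<open>The least node of the chain is the deepest, and \<open>i0\<close> attains
      it.\<close>
    have level: "max_below (\<lambda>m. F m K) M = depth t"
    proof -
      have "max_below (\<lambda>m. F m K) M = max_below (\<lambda>i. G i K) (Suc l)"
        by (intro max_below_reindex[of l ns]) (auto simp: F_ns F_out ns_M)
      also have "\<dots> = depth t"
      proof (rule antisym)
        show "max_below (\<lambda>i. G i K) (Suc l) \<le> depth t"
          unfolding max_below_le_iff using G_le by simp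
        show "depth t \<le> max_below (\<lambda>i. G i K) (Suc l)"
          using max_below_upper[of i0 "Suc l" "\<lambda>i. G i K"] i0 G_K by simp
      qed
      finally show ?thesis .
    qed
    have "{x. y x \<noteq> 0} \<subseteq> (\<Union>m<M. {x. b m x \<noteq> 0})"
    proof
      fix x assume "x \<in> {x. y x \<noteq> 0}"
      then obtain m where m: "m < M" "F m (b m x) \<noteq> 0"
        by (auto simp: y_def merged_def max_below_eq_0_iff)
      then have "b m x \<noteq> 0" using collapse_0[OF F_collapse[of m]] by metis
      with m show "x \<in> (\<Union>m<M. {x. b m x \<noteq> 0})" by auto
    qed
    then have "finite {x. y x \<noteq> 0}" by (rule finite_subset) (simp add: b_fin del: neq0_conv)
    then have FIN: "lift t y \<in> FIN T r E" using t y_le by (intro lift_in_FIN) auto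
    have "fin_sum (map (\<lambda>i. tau T r (f i) (B (ts i) (ns i))) [0..<Suc l])
        = fin_sum (map (\<lambda>i. lift t (act (G i) (b (ns i)))) [0..<Suc l])"
      using summand by (intro arg_cong[where f = fin_sum] map_cong) auto
    also have "\<dots> = Some (lift t y)"
      unfolding y
    proof (rule fin_sum_lift)
      fix i j x assume ij: "i < j" "j < Suc l"
      then have "ns i < ns j" using strict_mono_onD[OF ns, of i j] by simp
      then have "b (ns i) x = 0 \<or> b (ns j) x = 0" using b_less[of "ns i" x "ns j" x] by blast
      then show "act (G i) (b (ns i)) x = 0 \<or> act (G j) (b (ns j)) x = 0"
        using collapse_0[OF G_collapse[of i]] collapse_0[OF G_collapse[of j]] ij by (auto simp: act_def)
    qed
    finally have sum: "fin_sum (map (\<lambda>i. tau T r (f i) (B (ts i) (ns i))) [0..<Suc l]) = Some (lift t y)" .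
    \<comment> \<open>The path theorem fixes the whole tuple \<open>c' y\<close> by the depth of
      \<open>t\<close>; its entry at \<open>t\<close> is the required colour.\<close>
    have "c (lift t y) = c' y t" using t FIN by (simp add: c'_def)
    also have "c' y = \<chi> (depth t)"
      using colour[of M F] F_collapse level by (simp add: y_def)
    finally have "c (lift t y) = \<chi> (depth t) t" .
    with FIN sum show ?thesis by blast
  qed
  show ?thesis
  proof (intro exI[of _ B] conjI)
    show "\<forall>t\<in>T. \<forall>n. B t n \<in> FIN_at T r E t" using B_FIN_at by blast
    show "\<forall>t\<in>T. \<forall>n. (\<forall>m\<in>dom (B t n). d n < m) \<and> set_less (dom (B t n)) (dom (B t (Suc n)))"
      unfolding set_less_def using dom_B b_lower(2) b_less lessI by metis
  qed (intro exI[of _ "\<lambda>t. \<chi> (depth t) t"] allI impI, rule sums, blast+)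
qed

end
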